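(* Let $R$ be a commutative ring with unity having ideals $I,J,K$ such that $(I+K)\cap(J+K)\neq(I\cap J)+K$. Then there exists an edge-labeling $\alpha$ of the diamond graph over $R$ such that $(\text{diamond},\alpha)$ does not satisfy the Universal Difference Property.
   Context: The diamond graph is the graph on 4 vertices with 5 edges (the complete graph $K_4$ with one edge removed). An edge-labeling assigns to each edge an ideal of $R$. A spline on $(G,\alpha)$ is a function $\rho:V(G)\to R$ with $\rho(u)-\rho(v)\in\alpha(uv)$ for every edge $uv$. For a path $P$ (no repeated vertices), $\alpha(P)$ is the sum of the labels of its edges. $(G,\alpha)$ satisfies the Universal Difference Property if for every pair of vertices $u,w$ and every $x\in\bigcap_P\alpha(P)$ (over all paths $P$ from $u$ to $w$) there is a spline $\rho$ with $\rho(u)-\rho(w)=x$. *)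

theory Defs
  imports "HOL-Algebra.Algebra"
begin

text \<open>
  A simple graph is given by a vertex set and a set of edges, an edge being a two-element set
  of vertices.
\<close>

definition complete_edges :: "'v set \<Rightarrow> 'v set set" where
  "complete_edges V = {{u, v} | u v. u \<in> V \<and> v \<in> V \<and> u \<noteq> v}"

definition diamond_verts :: "nat set" where
  "diamond_verts = {0, 1, 2, 3}"

definition diamond_edges :: "nat set set" where
  "diamond_edges = complete_edges diamond_verts - {{0, 3}}"

lemma diamond_edges_eq: "diamond_edges = {{0, 1}, {0, 2}, {1, 2}, {1, 3}, {2, 3}}"
proof -
  have "complete_edges diamond_verts =
      (\<Union>u\<in>diamond_verts. (\<lambda>v. {u, v}) ` (diamond_verts - {u}))"
    unfolding complete_edges_def by blast
  also have "\<dots> = {{0, 1}, {0, 2}, {0, 3}, {1, 2}, {1, 3}, {2, 3}}"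
    by (simp add: diamond_verts_def insert_Diff_if insert_commute)
  finally show ?thesis
    by (simp add: diamond_edges_def insert_Diff_if doubleton_eq_iff)
qed

lemma card_diamond_verts: "card diamond_verts = 4"
  by (simp add: diamond_verts_def)

lemma card_diamond_edges: "card diamond_edges = 5"
  by (simp add: diamond_edges_eq doubleton_eq_iff)

definition edge_labeling :: "('a, 'b) ring_scheme \<Rightarrow> 'v set set \<Rightarrow> ('v set \<Rightarrow> 'a set) \<Rightarrow> bool" where
  "edge_labeling R E \<alpha> \<longleftrightarrow> (\<forall>e\<in>E. ideal (\<alpha> e) R)"

definition spline ::
  "('a, 'b) ring_scheme \<Rightarrow> 'v set \<Rightarrow> 'v set set \<Rightarrow> ('v set \<Rightarrow> 'a set) \<Rightarrow> ('v \<Rightarrow> 'a) \<Rightarrow> bool" where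
  "spline R V E \<alpha> \<rho> \<longleftrightarrow>
     \<rho> \<in> V \<rightarrow> carrier R \<and> (\<forall>u v. {u, v} \<in> E \<longrightarrow> \<rho> u \<ominus>\<^bsub>R\<^esub> \<rho> v \<in> \<alpha> {u, v})"

definition path_between :: "'v set \<Rightarrow> 'v set set \<Rightarrow> 'v \<Rightarrow> 'v \<Rightarrow> 'v list \<Rightarrow> bool" where
  "path_between V E u w p \<longleftrightarrow>
     p \<noteq> [] \<and> hd p = u \<and> last p = w \<and> set p \<subseteq> V \<and> distinct p \<and>
     successively (\<lambda>x y. {x, y} \<in> E) p"

definition path_edges :: "'v list \<Rightarrow> 'v set list" where
  "path_edges p = map (\<lambda>(x, y). {x, y}) (zip p (tl p))"

text \<open>
  The label of a one-vertex path is the empty sum of ideals, that is, the zero ideal.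
\<close>

definition path_label :: "('a, 'b) ring_scheme \<Rightarrow> ('v set \<Rightarrow> 'a set) \<Rightarrow> 'v list \<Rightarrow> 'a set" where
  "path_label R \<alpha> p = foldr (\<lambda>e S. \<alpha> e <+>\<^bsub>R\<^esub> S) (path_edges p) {\<zero>\<^bsub>R\<^esub>}"

text \<open>
  Requiring \<open>x \<in> carrier R\<close> makes the intersection over an empty family of paths the whole ring.
\<close>

definition universal_difference_property ::
  "('a, 'b) ring_scheme \<Rightarrow> 'v set \<Rightarrow> 'v set set \<Rightarrow> ('v set \<Rightarrow> 'a set) \<Rightarrow> bool" where
  "universal_difference_property R V E \<alpha> \<longleftrightarrow>
     (\<forall>u\<in>V. \<forall>w\<in>V. \<forall>x\<in>carrier R.
        (\<forall>p. path_between V E u w p \<longrightarrow> x \<in> path_label R \<alpha> p) \<longrightarrow>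
        (\<exists>\<rho>. spline R V E \<alpha> \<rho> \<and> \<rho> u \<ominus>\<^bsub>R\<^esub> \<rho> w = x))"

end

theory Submission
  imports Defs
begin

text \<open>
  Label the two edges at vertex 0 by \<open>I\<close> and \<open>J\<close>, the two edges at vertex 3 by \<open>K\<close>, and the
  middle edge by the zero ideal. Every path from 0 to 3 then has label \<open>I + K\<close> or \<open>J + K\<close>, whereas
  a spline agrees on the two middle vertices, so its difference between 0 and 3 lies in
  \<open>(I \<inter> J) + K\<close>.
\<close>

definition diamond_labeling ::
  "('a, 'b) ring_scheme \<Rightarrow> 'a set \<Rightarrow> 'a set \<Rightarrow> 'a set \<Rightarrow> nat set \<Rightarrow> 'a set" where
  "diamond_labeling R I J K e =
     (if e = {0, 1} then I else if e = {0, 2} then J else if e = {1, 2} then {\<zero>\<^bsub>R\<^esub>} else K)"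

text \<open>The middle edge appears in both orientations because the path
  \<open>[0, 2, 1, 3]\<close> crosses it from 2 to 1.\<close>

lemma diamond_labeling_simps [simp]:
  "diamond_labeling R I J K {0, 1} = I"
  "diamond_labeling R I J K {0, 2} = J"
  "diamond_labeling R I J K {1, 2} = {\<zero>\<^bsub>R\<^esub>}"
  "diamond_labeling R I J K {2, 1} = {\<zero>\<^bsub>R\<^esub>}"
  "diamond_labeling R I J K {1, 3} = K"
  "diamond_labeling R I J K {2, 3} = K"
  by (auto simp: diamond_labeling_def doubleton_eq_iff)

lemma mem_diamond_edges_iff:
  "{x, y} \<in> diamond_edges \<longleftrightarrow>
     (x = 0 \<and> y \<in> {1, 2}) \<or> (x = 1 \<and> y \<in> {0, 2, 3}) \<or> (x = 2 \<and> y \<in> {0, 1, 3}) \<or>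
     (x = 3 \<and> y \<in> {1, 2})"
  unfolding diamond_edges_eq by (auto simp: doubleton_eq_iff)

text \<open>Peel vertices off the front: adjacency and distinctness restrict each next vertex. The
  nonadjacency of 0 and 3 forces a first step to 1 or 2, after which the path either goes to 3 or
  first crosses the middle edge.\<close>

lemma diamond_path_0_3:
  assumes "path_between diamond_verts diamond_edges 0 3 p"
  shows "p \<in> {[0, 1, 3], [0, 2, 3], [0, 1, 2, 3], [0, 2, 1, 3]}"
proof -
  have hd: "hd p = 0" and last: "last p = 3" and ne: "p \<noteq> []" and dist: "distinct p"
    and succ: "successively (\<lambda>x y. {x, y} \<in> diamond_edges) p"
    using assms by (auto simp: path_between_def)
  obtain q where p: "p = 0 # q"
    using hd ne by (cases p) auto
  obtain b r where q: "q = b # r"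
    using last p by (cases q) auto
  have b: "b = 1 \<or> b = 2"
    using succ unfolding p q by (simp add: mem_diamond_edges_iff)
  obtain c s where r: "r = c # s"
    using last b unfolding p q by (cases r) auto
  have c: "c = 3 \<or> (b = 1 \<and> c = 2) \<or> (b = 2 \<and> c = 1)"
    using succ dist b unfolding p q r by (auto simp: mem_diamond_edges_iff)
  show ?thesis
  proof (cases "c = 3")
    case True
    \<comment> \<open>A nonempty tail would end in 3, repeating the vertex
      \<open>c = 3\<close>.\<close>
    have "s = []"
      using last dist True unfolding p q r by (cases s rule: rev_cases) auto
    with True b show ?thesis
      unfolding p q r by auto
  next
    case False
    obtain d t where s: "s = d # t"
      using last False unfolding p q r by (cases s) auto
    have d: "d = 3"
      using succ dist b c False unfolding p q r s by (auto simp: mem_diamond_edges_iff)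
    have "t = []"
      using last dist d unfolding p q r s by (cases t rule: rev_cases) auto
    with b c d False show ?thesis
      unfolding p q r s by auto
  qed
qed

text \<open>Sums of sets are monotone. Hence the assumed inequality can only be a failure of the
  reverse inclusion, which supplies the element that violates the property.\<close>

lemma inter_set_add_subset:
  "(I \<inter> J) <+>\<^bsub>R\<^esub> K \<subseteq> (I <+>\<^bsub>R\<^esub> K) \<inter> (J <+>\<^bsub>R\<^esub> K)"
  by (auto simp: set_add_def')

text \<open>Crossing the middle edge adds only zero, so the label of a path depends only on its
  first edge: \<open>I\<close> or \<open>J\<close>, followed by \<open>K\<close>.\<close>

lemma (in ring) mem_diamond_path_label:
  assumes K: "ideal K R"
    and x: "x \<in> (I <+>\<^bsub>R\<^esub> K) \<inter> (J <+>\<^bsub>R\<^esub> K)"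
    and p: "path_between diamond_verts diamond_edges 0 3 p"
  shows "x \<in> path_label R (diamond_labeling R I J K) p"
proof -
  have "K \<subseteq> carrier R"
    using K by (auto dest: ideal.Icarr)
  \<comment> \<open>\<open>K0\<close> absorbs the zero ideal that ends the fold in
    \<open>path_label\<close>; \<open>ZK\<close> absorbs the label of the middle edge.\<close>
  then have K0: "K <+>\<^bsub>R\<^esub> {\<zero>} = K" and ZK: "{\<zero>} <+>\<^bsub>R\<^esub> K = K"
    by (force simp: set_add_def')+
  show ?thesis
    using diamond_path_0_3[OF p] x
    by (auto simp: path_label_def path_edges_def K0 ZK simp del: One_nat_def)
qed

lemma (in ring) diamond_spline_difference:
  assumes \<rho>: "spline R diamond_verts diamond_edges (diamond_labeling R I J K) \<rho>"
  shows "\<rho> 0 \<ominus> \<rho> 3 \<in> (I \<inter> J) <+>\<^bsub>R\<^esub> K"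
proof -
  have carr: "\<rho> 0 \<in> carrier R" "\<rho> 1 \<in> carrier R" "\<rho> 2 \<in> carrier R" "\<rho> 3 \<in> carrier R"
    using \<rho> unfolding spline_def diamond_verts_def by auto
  have edge: "\<rho> u \<ominus> \<rho> v \<in> diamond_labeling R I J K {u, v}" if "{u, v} \<in> diamond_edges" for u v
    using \<rho> that unfolding spline_def by blast
  have "\<rho> 1 \<ominus> \<rho> 2 = \<zero>"
    using edge[of 1 2] by (simp add: mem_diamond_edges_iff del: One_nat_def)
  then have "\<rho> 1 = \<rho> 2"
    using carr by simp
  moreover have "\<rho> 0 \<ominus> \<rho> 1 \<in> I" "\<rho> 0 \<ominus> \<rho> 2 \<in> J" "\<rho> 1 \<ominus> \<rho> 3 \<in> K"
    using edge[of 0 1] edge[of 0 2] edge[of 1 3]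
    by (simp_all add: mem_diamond_edges_iff del: One_nat_def)
  \<comment> \<open>Telescope through vertex 1. Since \<open>\<rho> 1 = \<rho> 2\<close>, the first
    summand lies in both \<open>I\<close> and \<open>J\<close>; the second lies in
    \<open>K\<close>.\<close>
  moreover have "\<rho> 0 \<ominus> \<rho> 3 = (\<rho> 0 \<ominus> \<rho> 1) \<oplus> (\<rho> 1 \<ominus> \<rho> 3)"
    using carr by (simp add: a_minus_def a_assoc r_neg1)
  ultimately show ?thesis
    unfolding set_add_def' by auto
qed

theorem theorem3p9:
  fixes R :: "('a, 'b) ring_scheme" and I J K :: "'a set"
  assumes "cring R"
    and "ideal I R" and "ideal J R" and "ideal K R"
    and "(I <+>\<^bsub>R\<^esub> K) \<inter> (J <+>\<^bsub>R\<^esub> K) \<noteq> (I \<inter> J) <+>\<^bsub>R\<^esub> K"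
  shows "\<exists>\<alpha>. edge_labeling R diamond_edges \<alpha> \<and>
             \<not> universal_difference_property R diamond_verts diamond_edges \<alpha>"
proof (intro exI conjI)
  interpret cring R by fact
  let ?\<alpha> = "diamond_labeling R I J K"
  show "edge_labeling R diamond_edges ?\<alpha>"
    using assms(2-4) zeroideal by (simp add: edge_labeling_def diamond_labeling_def)
  obtain x where x: "x \<in> (I <+>\<^bsub>R\<^esub> K) \<inter> (J <+>\<^bsub>R\<^esub> K)" and notin: "x \<notin> (I \<inter> J) <+>\<^bsub>R\<^esub> K"
    using inter_set_add_subset[where R = R and I = I and J = J and K = K] assms(5) by blast
  have "x \<in> carrier R"
    using x ideal.Icarr[OF add_ideals[OF assms(2,4)]] by blast
  moreover have "\<forall>p. path_between diamond_verts diamond_edges 0 3 p \<longrightarrow> x \<in> path_label R ?\<alpha> p"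
    using mem_diamond_path_label[OF assms(4) x] by blast
  moreover have "0 \<in> diamond_verts" "3 \<in> diamond_verts"
    by (simp_all add: diamond_verts_def)
  \<comment> \<open>A spline with difference \<open>x\<close> between 0 and 3 would put
    \<open>x\<close> in \<open>(I \<inter> J) + K\<close>, contrary to its choice.\<close>
  ultimately show "\<not> universal_difference_property R diamond_verts diamond_edges ?\<alpha>"
    using diamond_spline_difference notin
    unfolding universal_difference_property_def by blast
qed

end
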